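(* Let $k$ be a positive integer and define $c(n,k)$, $n\ge 0$, by $(1-k^2x)^{-1/k}=\sum_{n\ge 0}c(n,k)x^n$. Then for every $n>0$, $c(n,k)$ is a positive integer divisible by $k$.
   Context: Equivalently, $c(n,k)=\frac{k^n}{n!}\prod_{m=1}^{n-1}(1+km)$ (empty product $=1$). *)

theory Defs
  imports "HOL-Computational_Algebra.Formal_Power_Series"
begin

text \<open>
  \<^term>\<open>fps_binomial a\<close> is the library's formal power series for $(1 + X)^a$ (with constant
  term 1); substituting $-k^2 X$ for $X$ gives $(1 - k^2 X)^{-1/k}$. For \<open>k = 0\<close> the
  definition has no meaning (division by zero).
\<close>

definition gen_fun :: "nat \<Rightarrow> rat fps" where
  "gen_fun k = fps_compose (fps_binomial (- 1 / of_nat k)) (- fps_const (of_nat k ^ 2) * fps_X)"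

definition c :: "nat \<Rightarrow> nat \<Rightarrow> rat" where
  "c n k = fps_nth (gen_fun k) n"

text \<open>
  For \<open>k > 0\<close>, \<^term>\<open>gen_fun k\<close> is the series with constant term 1 whose \<open>k\<close>-th power is
  $1/(1 - k^2 X)$.
\<close>

lemma gen_fun_nth_0: "fps_nth (gen_fun k) 0 = 1"
  by (simp add: gen_fun_def)

lemma gen_fun_power:
  assumes "k > 0"
  shows "gen_fun k ^ k = inverse (1 - fps_const (of_nat k ^ 2) * fps_X)"
proof -
  have "gen_fun k ^ k
      = fps_compose (fps_binomial (- of_nat 1)) (- fps_const (of_nat k ^ 2) * fps_X)"
    using assms by (simp add: gen_fun_def fps_compose_power fps_binomial_power)
  also have "\<dots> = inverse (1 - fps_const (of_nat k ^ 2) * fps_X)"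
    by (subst one_minus_fps_X_const_neg_power [symmetric]) simp
  finally show ?thesis .
qed

end

theory Submission
  imports Defs
begin

text \<open>
  Put \<open>f = gen_fun k = 1 + k g\<close>. Expanding \<open>f ^ k = 1 / (1 - k\<^sup>2 X)\<close> and dividing by \<open>k\<^sup>2\<close> gives
  \<open>g = X / (1 - k\<^sup>2 X) - (\<Sum>j = 2..k. (k choose j) k\<^sup>j\<^sup>-\<^sup>2 g\<^sup>j)\<close>. As \<open>g\<close> has no constant term, the
  \<open>n\<close>-th coefficient of the right-hand side only involves coefficients of \<open>g\<close> below \<open>n\<close>, so all
  coefficients of \<open>g\<close> are integers by induction.
\<close>

lemma fps_power_nth_Ints:
  fixes f :: "'a::comm_ring_1 fps"
  assumes "\<And>i. i \<le> n \<Longrightarrow> fps_nth f i \<in> \<int>"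
  shows "fps_nth (f ^ j) n \<in> \<int>"
  using assms
proof (induction j arbitrary: n)
  case 0
  then show ?case by (simp add: fps_one_nth)
next
  case (Suc j)
  then show ?case by (auto simp: fps_mult_nth intro!: Ints_sum Ints_mult)
qed

text \<open>In \<open>f * f ^ l\<close> with \<open>l > 0\<close>, the coefficient of index
  \<open>n\<close> of either factor meets the zero constant term of the other, so only coefficients
  of \<open>f\<close> below \<open>n\<close> contribute.\<close>

lemma fps_power_nth_Ints_strict:
  fixes f :: "'a::comm_ring_1 fps"
  assumes "fps_nth f 0 = 0" and "\<And>i. i < n \<Longrightarrow> fps_nth f i \<in> \<int>" and "j \<ge> 2"
  shows "fps_nth (f ^ j) n \<in> \<int>"
proof -
  obtain l where l: "j = Suc l" "l > 0"
    using assms(3) by (cases j) auto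
  have "fps_nth f i * fps_nth (f ^ l) (n - i) \<in> \<int>" if le: "i \<le> n" for i
  proof -
    consider "i = 0" | "i = n" | "0 < i" "i < n"
      using le by linarith
    then show ?thesis
    proof cases
      case 2
      then show ?thesis using assms(1) l(2) by (simp add: fps_nth_power_0 power_0_left)
    next
      case 3
      then show ?thesis
        by (intro Ints_mult fps_power_nth_Ints assms(2)) auto
    qed (use assms(1) in simp)
  qed
  then show ?thesis
    by (auto simp: l(1) fps_mult_nth intro!: Ints_sum)
qed

text \<open>The signs of \<open>(- (k ^ 2)) ^ n\<close> and of the binomial coefficient at
  \<open>- 1 / k\<close> cancel, leaving a rising factorial of \<open>1 / k\<close>.\<close>

lemma c_pos:
  assumes "k > 0"
  shows "c n k > 0"
proof -
  have "c n k = (- (of_nat k ^ 2)) ^ n * ((- 1 / of_nat k) gchoose n)"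
    unfolding c_def gen_fun_def fps_const_neg
    by (subst fps_compose_linear) simp
  also have "\<dots> = (of_nat k ^ 2) ^ n * pochhammer (1 / of_nat k) n / fact n"
    by (simp add: gbinomial_pochhammer flip: power_mult_distrib mult.assoc)
  also have "\<dots> > 0"
    using assms by (intro divide_pos_pos mult_pos_pos pochhammer_pos) auto
  finally show ?thesis .
qed

text \<open>Integrality of the quotient yields both integrality of \<open>c n k\<close> and
  divisibility by \<open>k\<close>.\<close>

lemma c_div_Ints:
  assumes "k > 0" and "n > 0"
  shows "c n k / of_nat k \<in> \<int>"
proof -
  define K :: rat where "K = of_nat k"
  have K: "K \<noteq> 0" using assms by (simp add: K_def)
  define g where "g = fps_const (1 / K) * (gen_fun k - 1)"
  have f: "gen_fun k = fps_const K * g + 1"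
    using K by (simp add: g_def flip: mult.assoc)
  have g0: "fps_nth g 0 = 0"
    by (simp add: g_def gen_fun_nth_0)
  have geometric: "inverse (1 - fps_const (K ^ 2) * fps_X) = Abs_fps (\<lambda>n. (K ^ 2) ^ n)"
  proof (rule fps_inverse_unique)
    show "(1 - fps_const (K ^ 2) * fps_X) * Abs_fps (\<lambda>n. (K ^ 2) ^ n) = 1"
      by (rule fps_ext) (simp add: left_diff_distrib mult.assoc flip: power_Suc)
  qed
  define r where "r = (\<Sum>j=2..k. fps_const (of_nat (k choose j) * K ^ (j - 2)) * g ^ j)"
  have "gen_fun k ^ k = (\<Sum>j\<le>k. of_nat (k choose j) * (fps_const K * g) ^ j)"
    unfolding f binomial_ring by simp
  also have "{..k} = insert 0 (insert 1 {2..k})"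
    using assms by auto
  \<comment> \<open>The linear term has coefficient \<open>(k choose 1) * K = K ^ 2\<close>, the
    same factor that every term with \<open>j \<ge> 2\<close> contains.\<close>
  also have "(\<Sum>j\<in>insert 0 (insert 1 {2..k}). of_nat (k choose j) * (fps_const K * g) ^ j)
      = 1 + fps_const (K ^ 2) * g + (\<Sum>j=2..k. of_nat (k choose j) * (fps_const K * g) ^ j)"
    by (simp add: K_def power2_eq_square fps_of_nat mult.assoc add.assoc flip: fps_const_mult)
  also have "(\<Sum>j=2..k. of_nat (k choose j) * (fps_const K * g) ^ j) = fps_const (K ^ 2) * r"
    unfolding r_def sum_distrib_left
  proof (rule sum.cong)
    fix j assume "j \<in> {2..k}"
    then have "K ^ j = K ^ 2 * K ^ (j - 2)"
      by (subst power_add [symmetric], subst le_add_diff_inverse) auto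
    then show "of_nat (k choose j) * (fps_const K * g) ^ j
        = fps_const (K ^ 2) * (fps_const (of_nat (k choose j) * K ^ (j - 2)) * g ^ j)"
      by (simp add: power_mult_distrib fps_const_power mult_ac flip: fps_of_nat fps_const_mult)
  qed simp
  finally have eq: "1 + fps_const (K ^ 2) * g + fps_const (K ^ 2) * r
      = Abs_fps (\<lambda>n. (K ^ 2) ^ n)"
    using gen_fun_power[OF assms(1)] geometric by (simp add: K_def)
  \<comment> \<open>For \<open>m > 0\<close> the constant 1 drops out and \<open>(K ^ 2) ^ m\<close>
    still contains the factor \<open>K ^ 2\<close>, so cancelling it leaves an integer
    power.\<close>
  have rec: "fps_nth g m = (K ^ 2) ^ (m - 1) - fps_nth r m" if "m > 0" for m
  proof -
    have "K ^ 2 * (fps_nth g m + fps_nth r m) = (K ^ 2) ^ m"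
      using arg_cong[OF eq, of "\<lambda>F. fps_nth F m"] that by (simp add: distrib_left)
    also have "\<dots> = K ^ 2 * (K ^ 2) ^ (m - 1)"
      using that by (cases m) auto
    finally show ?thesis
      using K by (simp add: eq_diff_eq)
  qed
  have "fps_nth g m \<in> \<int>" for m
  proof (induction m rule: less_induct)
    case (less m)
    show ?case
    proof (cases "m = 0")
      case False
      have "fps_nth r m \<in> \<int>"
        unfolding r_def fps_sum_nth fps_mult_left_const_nth K_def
        using less g0
        by (intro Ints_sum Ints_mult Ints_power Ints_of_nat fps_power_nth_Ints_strict) auto
      then show ?thesis
        using rec False by (auto simp: K_def intro!: Ints_diff Ints_power)
    qed (simp add: g0)
  qed
  \<comment> \<open>As \<open>n > 0\<close>, subtracting 1 from the series leaves coefficient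
    \<open>n\<close> unchanged.\<close>
  moreover have "fps_nth g n = c n k / of_nat k"
    using assms(2) by (simp add: g_def c_def K_def)
  ultimately show ?thesis by metis
qed

theorem theorem2p3:
  fixes k n :: nat
  assumes "k > 0" and "n > 0"
  shows "\<exists>m::nat. c n k = of_nat m \<and> m > 0 \<and> k dvd m"
proof -
  obtain z where z: "c n k / of_nat k = of_int z"
    using c_div_Ints[OF assms] by (auto elim: Ints_cases)
  have "c n k / of_nat k > 0"
    using c_pos[OF assms(1)] assms(1) by simp
  then have "z > 0"
    by (simp add: z)
  then have "c n k / of_nat k = of_nat (nat z)"
    by (simp add: z)
  then have "c n k = of_nat (k * nat z)"
    using assms(1) by (simp add: field_simps)
  then show ?thesis
    using \<open>z > 0\<close> assms(1) by (intro exI[of _ "k * nat z"]) auto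
qed

end
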